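(* Let $G$ be a simple connected graph. Then its Gallai simplicial complex $\Delta_\Gamma(G)$ is connected.
   Context: $G$ is a finite simple graph with vertex set $V(G)=[n]=\{1,\dots,n\}$ and edge set $E(G)$; write $e_{i,j}=\{i,j\}$ for an edge. The Gallai graph $\Gamma(G)$ is the graph whose vertex set is $E(G)$; two distinct edges of $G$ are adjacent in $\Gamma(G)$ if they are incident in $G$ (share a vertex) but do not span a triangle in $G$. The set of Gallai-indices $\Omega(G)$ is the collection of the following subsets of $V(G)$: $F_{i,j,k}=\{i,j,k\}$ whenever $e_{i,j}$ and $e_{j,k}$ are adjacent in $\Gamma(G)$, and $F_{i,j}=\{i,j\}$ whenever $e_{i,j}$ is an isolated vertex of $\Gamma(G)$. The Gallai simplicial complex of $G$ is the simplicial complex $\Delta_\Gamma(G)=\langle F\mid F\in\Omega(G)\rangle$ over $V(G)$, i.e. the complex consisting of all subsets of members of $\Omega(G)$. A simplicial complex $\Delta$ is connected if for any two facets (maximal faces) $F$ and $F'$ of $\Delta$ there exists a sequence of facets $F=F_0,F_1,\dots,F_t=F'$ such that $F_i\cap F_{i+1}\neq\emptyset$ for all $i\in\{0,1,\dots,t-1\}$. *)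

theory Defs
  imports Main
begin

text \<open>A graph is a pair of a vertex set and a set of edges, an edge being the set of its two
  end points.\<close>

type_synonym 'a graph = "'a set \<times> 'a set set"

abbreviation verts :: "'a graph \<Rightarrow> 'a set" where
  "verts G \<equiv> fst G"

abbreviation edges :: "'a graph \<Rightarrow> 'a set set" where
  "edges G \<equiv> snd G"

definition simple_graph :: "'a graph \<Rightarrow> bool" where
  "simple_graph G \<longleftrightarrow> finite (verts G) \<and> (\<forall>e\<in>edges G. e \<subseteq> verts G \<and> card e = 2)"

definition connected_graph :: "'a graph \<Rightarrow> bool" where
  "connected_graph G \<longleftrightarrow>
     (\<forall>u\<in>verts G. \<forall>v\<in>verts G. \<exists>t w.
        w (0::nat) = u \<and> w t = v \<and> (\<forall>i<t. {w i, w (Suc i)} \<in> edges G))"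

definition isolated_vertex :: "'a graph \<Rightarrow> 'a \<Rightarrow> bool" where
  "isolated_vertex G v \<longleftrightarrow> v \<in> verts G \<and> (\<forall>u\<in>verts G. {u, v} \<notin> edges G)"

definition spans_triangle :: "'a graph \<Rightarrow> 'a set \<Rightarrow> 'a set \<Rightarrow> bool" where
  "spans_triangle G e f \<longleftrightarrow>
     (\<exists>i j k. distinct [i, j, k] \<and> e = {i, j} \<and> f = {j, k} \<and>
        {i, j} \<in> edges G \<and> {j, k} \<in> edges G \<and> {i, k} \<in> edges G)"

definition gallai_graph :: "'a graph \<Rightarrow> 'a set graph" where
  "gallai_graph G =
     (edges G,
      {{e, f} | e f. e \<in> edges G \<and> f \<in> edges G \<and> e \<noteq> f \<and> e \<inter> f \<noteq> {} \<and>
                     \<not> spans_triangle G e f})"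

text \<open>For a simple graph \<open>G\<close>, the indices \<open>i\<close>, \<open>j\<close>, \<open>k\<close> below are automatically pairwise distinct,
  since edges of \<open>G\<close> have two elements and adjacent vertices of the Gallai graph are different.\<close>

definition gallai_indices :: "'a graph \<Rightarrow> 'a set set" where
  "gallai_indices G =
     {{i, j, k} | i j k. {{i, j}, {j, k}} \<in> edges (gallai_graph G)} \<union>
     {{i, j} | i j. isolated_vertex (gallai_graph G) {i, j}}"

definition generated_complex :: "'a set set \<Rightarrow> 'a set set" where
  "generated_complex \<Omega> = {A. \<exists>F\<in>\<Omega>. A \<subseteq> F}"

definition gallai_complex :: "'a graph \<Rightarrow> 'a set set" where
  "gallai_complex G = generated_complex (gallai_indices G)"

definition facets :: "'a set set \<Rightarrow> 'a set set" where
  "facets \<Delta> = {F \<in> \<Delta>. \<forall>F'\<in>\<Delta>. F \<subseteq> F' \<longrightarrow> F' = F}"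

definition connected_complex :: "'a set set \<Rightarrow> bool" where
  "connected_complex \<Delta> \<longleftrightarrow>
     (\<forall>F\<in>facets \<Delta>. \<forall>F'\<in>facets \<Delta>. \<exists>t S.
        S (0::nat) = F \<and> S t = F' \<and> (\<forall>i\<le>t. S i \<in> facets \<Delta>) \<and>
        (\<forall>i<t. S i \<inter> S (Suc i) \<noteq> {}))"

end

theory Submission imports Defs
begin

text \<open>Every edge \<open>e\<close> of \<open>G\<close> is a face of the Gallai complex: either \<open>e\<close> is isolated in the
  Gallai graph and is itself a Gallai-index, or it has a neighbour \<open>f\<close> there and lies in the
  Gallai-index \<open>e \<union> f\<close>.  As the complex is finite, every edge lies in a facet.  Given two facets
  \<open>F\<close> and \<open>F'\<close>, which are nonempty sets of vertices, a walk in \<open>G\<close> from a vertex of \<open>F\<close> to a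
  vertex of \<open>F'\<close> yields the required chain: replace each edge of the walk by a facet containing
  it.  Consecutive facets share the vertex at which consecutive edges of the walk meet.\<close>

lemma connected_complex_if_edges_in_facets:
  assumes conn: "connected_graph G"
    and facet: "\<And>F. F \<in> facets \<Delta> \<Longrightarrow> F \<noteq> {} \<and> F \<subseteq> verts G"
    and cover: "\<And>e. e \<in> edges G \<Longrightarrow> \<exists>F\<in>facets \<Delta>. e \<subseteq> F"
  shows "connected_complex \<Delta>"
  unfolding connected_complex_def
proof (intro ballI)
  fix F F' assume F: "F \<in> facets \<Delta>" and F': "F' \<in> facets \<Delta>"
  obtain u v where u: "u \<in> F" "u \<in> verts G" and v: "v \<in> F'" "v \<in> verts G"
    using facet[OF F] facet[OF F'] by blast
  obtain t w where w: "w (0::nat) = u" "w t = v" "\<forall>i<t. {w i, w (Suc i)} \<in> edges G"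
    using conn[unfolded connected_graph_def, rule_format, OF u(2) v(2)] by (elim exE conjE)
  have "\<forall>i. \<exists>H. i < t \<longrightarrow> H \<in> facets \<Delta> \<and> {w i, w (Suc i)} \<subseteq> H"
    using w(3) cover by blast
  from choice[OF this] obtain H
    where H: "\<And>i. i < t \<Longrightarrow> H i \<in> facets \<Delta>"
      and wH: "\<And>i. i < t \<Longrightarrow> w i \<in> H i" "\<And>i. i < t \<Longrightarrow> w (Suc i) \<in> H i"
    by blast
  \<comment> \<open>The chain \<open>F, H 0, \<dots>, H (t - 1), F'\<close> has length \<open>t + 1\<close>; its members \<open>i\<close> and \<open>i + 1\<close>
    share the vertex \<open>w i\<close>.\<close>
  define S where "S i = (if i = 0 then F else if i \<le> t then H (i - 1) else F')" for i
  have "S i \<in> facets \<Delta>" for i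
    using F F' H[of "i - 1"] by (auto simp: S_def)
  moreover have "w i \<in> S i \<inter> S (Suc i)" if "i < Suc t" for i
  proof
    show "w i \<in> S i"
      using that u(1) w(1) wH(2)[of "i - 1"] by (cases i) (auto simp: S_def)
    show "w i \<in> S (Suc i)"
    proof (cases "i < t")
      case True
      then show ?thesis using wH(1)[of i] by (simp add: S_def)
    next
      case False
      with that have "i = t" by simp
      then show ?thesis using v(1) w(2) by (simp add: S_def)
    qed
  qed
  then have "\<forall>i<Suc t. S i \<inter> S (Suc i) \<noteq> {}" by blast
  moreover have "S 0 = F" "S (Suc t) = F'" by (simp_all add: S_def)
  ultimately show "\<exists>t S. S 0 = F \<and> S t = F' \<and> (\<forall>i\<le>t. S i \<in> facets \<Delta>) \<and>
      (\<forall>i<t. S i \<inter> S (Suc i) \<noteq> {})"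
    by (intro exI[of _ "Suc t"] exI[of _ S]) simp
qed

lemma face_subset_facet:
  assumes "finite \<Delta>" "A \<in> \<Delta>"
  shows "\<exists>F\<in>facets \<Delta>. A \<subseteq> F"
proof -
  obtain F where F: "F \<in> \<Delta>" "A \<subseteq> F" and "\<forall>F'\<in>\<Delta>. F \<subseteq> F' \<longrightarrow> F = F'"
    using finite_has_maximal2[OF assms] by auto
  then have "F \<in> facets \<Delta>"
    by (auto simp: facets_def)
  with F(2) show ?thesis by (rule bexI)
qed

lemma facets_generated_complex_subset: "facets (generated_complex \<Omega>) \<subseteq> \<Omega>"
  unfolding facets_def generated_complex_def by blast

lemma gallai_graph_edgeD:
  assumes "{e, f} \<in> edges (gallai_graph G)"
  shows "e \<in> edges G" "f \<in> edges G" "e \<inter> f \<noteq> {}"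
  using assms unfolding gallai_graph_def by (auto simp: doubleton_eq_iff)

lemma gallai_index_nonempty: "F \<in> gallai_indices G \<Longrightarrow> F \<noteq> {}"
  unfolding gallai_indices_def by auto

lemma gallai_index_subset_verts:
  assumes G: "simple_graph G" and F: "F \<in> gallai_indices G"
  shows "F \<subseteq> verts G"
proof -
  have sub: "e \<subseteq> verts G" if "e \<in> edges G" for e
    using G that unfolding simple_graph_def by blast
  from F consider
      (adj) i j k where "F = {i, j, k}" "{{i, j}, {j, k}} \<in> edges (gallai_graph G)"
    | (iso) i j where "F = {i, j}" "isolated_vertex (gallai_graph G) {i, j}"
    unfolding gallai_indices_def by blast
  then show ?thesis
  proof cases
    case adj
    then show ?thesis
      using sub[OF gallai_graph_edgeD(1)[OF adj(2)]] sub[OF gallai_graph_edgeD(2)[OF adj(2)]]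
      by simp
  next
    case iso
    then show ?thesis
      using sub[of F] by (simp add: isolated_vertex_def gallai_graph_def)
  qed
qed

lemma finite_gallai_complex:
  assumes "simple_graph G"
  shows "finite (gallai_complex G)"
proof (rule finite_subset)
  show "gallai_complex G \<subseteq> Pow (verts G)"
    using gallai_index_subset_verts[OF assms]
    unfolding gallai_complex_def generated_complex_def by blast
  show "finite (Pow (verts G))"
    using assms by (simp add: simple_graph_def)
qed

lemma edge_in_gallai_complex:
  assumes G: "simple_graph G" and e: "e \<in> edges G"
  shows "e \<in> gallai_complex G"
proof (cases "isolated_vertex (gallai_graph G) e")
  case True
  obtain i j where "e = {i, j}"
    using G e unfolding simple_graph_def by (meson card_2_iff)
  with True have "e \<in> gallai_indices G"
    unfolding gallai_indices_def by blast
  then show ?thesis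
    unfolding gallai_complex_def generated_complex_def by blast
next
  case False
  then obtain f where f: "{f, e} \<in> edges (gallai_graph G)"
    using e by (auto simp: isolated_vertex_def gallai_graph_def)
  obtain j where j: "j \<in> f" "j \<in> e"
    using gallai_graph_edgeD(3)[OF f] by blast
  have other_end: "\<exists>i. g = {i, j}" if "g \<in> edges G" "j \<in> g" for g
  proof -
    have "card g = 2"
      using G that(1) by (simp add: simple_graph_def)
    then obtain a b where "g = {a, b}"
      by (meson card_2_iff)
    then show ?thesis
      using that(2) by blast
  qed
  obtain i where i: "f = {i, j}"
    using other_end[OF gallai_graph_edgeD(1)[OF f] j(1)] by blast
  obtain k where "e = {k, j}"
    using other_end[OF e j(2)] by blast
  with i have ik: "f = {i, j}" "e = {j, k}"
    by auto
  have "{i, j, k} \<in> gallai_indices G"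
    using f unfolding gallai_indices_def ik by blast
  then show ?thesis
    unfolding gallai_complex_def generated_complex_def ik by blast
qed

theorem lemma4p8:
  fixes G :: "nat graph" and n :: nat
  assumes "simple_graph G"
    and "verts G = {1..n}"
    and "connected_graph G"
  shows "connected_complex (gallai_complex G)"
proof (rule connected_complex_if_edges_in_facets[OF assms(3)])
  fix F assume "F \<in> facets (gallai_complex G)"
  then have "F \<in> gallai_indices G"
    using facets_generated_complex_subset unfolding gallai_complex_def by blast
  then show "F \<noteq> {} \<and> F \<subseteq> verts G"
    using gallai_index_nonempty gallai_index_subset_verts[OF assms(1)] by blast
next
  fix e assume "e \<in> edges G"
  then show "\<exists>F\<in>facets (gallai_complex G). e \<subseteq> F"
    using assms(1) by (intro face_subset_facet finite_gallai_complex edge_in_gallai_complex)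
qed

end
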